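(* Let $\mathfrak X$ be the set of all triples $(A,B,C)\in\mathbb Z^3$ with $A+B+C=0$, $\gcd(A,B,C)=1$ and $ABC\neq 0$. For $(A,B,C)\in\mathfrak X$ let $H(A,B,C)=\max\{|A|,|B|,|C|\}$, let $S(A,B,C)$ be the largest prime divisor of $ABC$ (with $S(A,B,C)=1$ if $ABC=\pm1$), and let $\mathcal I(A,B,C)$ be the insulator of $ABC$ (defined in the context). Assume the strong form of the XYZ Conjecture, namely: (a) for every $\epsilon>0$, only finitely many $(A,B,C)\in\mathfrak X$ satisfy $\log H(A,B,C)>S(A,B,C)^{2/3+\epsilon}$; and (b) for every $\epsilon>0$, infinitely many $(A,B,C)\in\mathfrak X$ satisfy $\log H(A,B,C)>S(A,B,C)^{2/3-\epsilon}$. Then for every positive integer $\mathcal I_0$, there are only finitely many $(A,B,C)\in\mathfrak X$ with $\mathcal I(A,B,C)=\mathcal I_0$.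
   Context: For a non-zero integer $n$, $P^+(n)$ denotes the largest prime divisor of $n$ (and $P^+(\pm1)=1$). A non-zero integer $n$ is called insulated if every prime $p\le P^+(n)$ divides $n$. The insulator of a non-zero integer $n$ is the smallest positive integer $m$ such that $n\cdot m$ is insulated. The insulator of $(A,B,C)\in\mathfrak X$ is $\mathcal I(A,B,C)=$ the insulator of the integer $ABC$. *)

theory Defs
  imports Complex_Main "HOL-Computational_Algebra.Primes"
begin

text \<open>The value at \<open>0\<close> is irrelevant: the notion is only used for non-zero integers.\<close>

definition largest_prime_divisor :: "int \<Rightarrow> int" where
  "largest_prime_divisor n =
     (if \<bar>n\<bar> = 1 then 1 else Max {p. prime p \<and> p dvd n})"

definition insulated :: "int \<Rightarrow> bool" where
  "insulated n \<longleftrightarrow>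
     n \<noteq> 0 \<and> (\<forall>p::int. prime p \<longrightarrow> p \<le> largest_prime_divisor n \<longrightarrow> p dvd n)"

definition insulator :: "int \<Rightarrow> nat" where
  "insulator n = (LEAST m::nat. m > 0 \<and> insulated (n * int m))"

definition XYZ_triples :: "(int \<times> int \<times> int) set" where
  "XYZ_triples =
     {(A, B, C). A + B + C = 0 \<and> Gcd {A, B, C} = 1 \<and> A * B * C \<noteq> 0}"

fun height :: "int \<times> int \<times> int \<Rightarrow> int" where
  "height (A, B, C) = Max {\<bar>A\<bar>, \<bar>B\<bar>, \<bar>C\<bar>}"

fun smoothness :: "int \<times> int \<times> int \<Rightarrow> int" where
  "smoothness (A, B, C) = largest_prime_divisor (A * B * C)"

fun triple_insulator :: "int \<times> int \<times> int \<Rightarrow> nat" where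
  "triple_insulator (A, B, C) = insulator (A * B * C)"

end

theory Submission imports Defs "HOL-Real_Asymp.Real_Asymp"
begin

text \<open>Multiplying a triple's product \<open>A B C\<close> by its insulator \<open>I\<^sub>0\<close> makes it divisible by every
  prime up to \<open>S\<close>, so \<open>2 ^ \<pi>(S) \<le> I\<^sub>0 H\<^sup>3\<close>. By Chebyshev's lower bound for \<open>\<pi>(S)\<close> this forces
  \<open>ln H > S powr (2/3 + 1/6)\<close> once \<open>S\<close> is large. The upper half of the XYZ conjecture leaves
  finitely many such triples, and all others have bounded \<open>S\<close>, hence bounded \<open>H\<close>.

  Chebyshev's bound comes from Leibniz's harmonic triangle: \<open>m (n choose m)\<close> divides every common
  multiple \<open>L\<close> of \<open>1, \<dots>, n\<close>, so \<open>2 ^ n \<le> (n + 1) L\<close>, whereas the least such \<open>L\<close> is a product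
  of \<open>\<pi>(n)\<close> prime powers not exceeding \<open>n\<close>.\<close>

section \<open>Chebyshev's lower bound for the prime counting function\<close>

text \<open>With \<open>c = n choose m\<close>, absorption turns
  \<open>Suc m * (Suc n choose Suc m)\<close> into \<open>Suc n * c\<close> and
  \<open>Suc n choose m\<close> into \<open>Suc n * c / (Suc n - m)\<close>; the rest is a fraction
  identity.\<close>

lemma leibniz_triangle:
  assumes "1 \<le> m" "m \<le> n"
  shows "1 / (real (Suc m) * real (Suc n choose Suc m)) =
    1 / (real m * real (n choose m)) - 1 / (real m * real (Suc n choose m))"
proof -
  define c where "c = real (n choose m)"
  have c: "c > 0" using assms by (simp add: c_def)
  have 1: "real (Suc m) * real (Suc n choose Suc m) = real (Suc n) * c"
    unfolding c_def by (metis Suc_times_binomial_eq of_nat_mult mult.commute)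
  have "(Suc n - m) * (Suc n choose m) = Suc n * (n choose m)"
    using binomial_absorb_comp[of "Suc n" m] by simp
  hence "(real (Suc n) - real m) * real (Suc n choose m) = real (Suc n) * c"
    using assms unfolding c_def by (metis le_SucI of_nat_diff of_nat_mult)
  moreover have pos: "real (Suc n) - real m > 0" using assms by simp
  ultimately have 2: "real (Suc n choose m) = real (Suc n) * c / (real (Suc n) - real m)"
    by (simp add: eq_divide_eq mult.commute)
  have m: "real m > 0" using assms by simp
  have n: "real (Suc n) > 0" by simp
  show ?thesis
    unfolding 1 2 c_def[symmetric] using c m n pos
    by (simp add: divide_simps del: of_nat_Suc)
qed

text \<open>An entry of the triangle is an entry of the previous row minus its left neighbour. So
  \<open>L\<close> clears the whole triangle as soon as it clears the border \<open>m = 1\<close>,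
  whose denominators are the row numbers.\<close>

lemma common_multiple_div_binomial_Ints:
  assumes "\<And>k. 1 \<le> k \<Longrightarrow> k \<le> n \<Longrightarrow> k dvd L" and "1 \<le> m" "m \<le> n"
  shows "real L / (real m * real (n choose m)) \<in> \<int>"
  using assms
proof (induction n arbitrary: m)
  case 0
  then show ?case by simp
next
  case (Suc n)
  have IH: "real L / (real m * real (n choose m)) \<in> \<int>" if "1 \<le> m" "m \<le> n" for m
    using Suc.IH[of m] Suc.prems(1) that by simp
  from \<open>1 \<le> m\<close> \<open>m \<le> Suc n\<close> show ?case
  proof (induction m rule: dec_induct)
    case base
    from Suc.prems(1)[of "Suc n"] obtain k where "L = Suc n * k" by auto
    then have "real L = real (Suc n) * real k" by (metis of_nat_mult)
    then have "real L / (real 1 * real (Suc n choose 1)) = real k"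
      by (simp del: of_nat_Suc)
    then show ?case by (metis Ints_of_nat)
  next
    case (step m)
    have "real L / (real (Suc m) * real (Suc n choose Suc m)) =
      real L / (real m * real (n choose m)) - real L / (real m * real (Suc n choose m))"
      using arg_cong[OF leibniz_triangle[of m n], of "\<lambda>x. real L * x"] step
      by (simp add: right_diff_distrib)
    then show ?case using step IH[of m] by (metis Ints_diff Suc_leD Suc_le_mono)
  qed
qed

text \<open>The \<open>n + 1\<close> binomials of row \<open>n\<close> sum to \<open>2 ^ n\<close>,
  and each is at most \<open>L\<close>.\<close>

lemma two_power_le_common_multiple:
  assumes "\<And>k. 1 \<le> k \<Longrightarrow> k \<le> n \<Longrightarrow> k dvd L" and "L > 0"
  shows "2 ^ n \<le> (n + 1) * L"
proof -
  have "n choose m \<le> L" if "m \<le> n" for m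
  \<comment> \<open>At \<open>m = 0\<close> the divisor \<open>m * (n choose m)\<close> vanishes,
    but there the binomial is just 1.\<close>
  proof (cases "m = 0")
    case True
    then show ?thesis using \<open>L > 0\<close> by simp
  next
    case False
    let ?d = "m * (n choose m)"
    have pos: "real ?d > 0" using that False by simp
    have "real L / real ?d \<in> \<int>"
      using common_multiple_div_binomial_Ints[OF assms(1), of n m] that False by simp
    moreover have "real L / real ?d > 0" using pos \<open>L > 0\<close> by simp
    ultimately have "real L / real ?d \<ge> 1"
      by (metis Ints_nonzero_abs_ge1 abs_of_pos less_irrefl)
    hence "?d \<le> L" using pos by (simp add: divide_simps del: of_nat_mult split: if_splits)
    moreover have "n choose m \<le> ?d" using False by simp
    ultimately show ?thesis by linarith
  qed
  hence "(\<Sum>m\<le>n. n choose m) \<le> (\<Sum>m\<le>n. L)" by (intro sum_mono) simp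
  thus ?thesis by (simp add: choose_row_sum)
qed

text \<open>The witness is the least common multiple of 1, ..., n: the product, over primes
  \<open>p \<le> n\<close>, of the largest power of \<open>p\<close> not exceeding
  \<open>n\<close>.\<close>

lemma common_multiple_le_power_card_primes:
  fixes n :: nat
  assumes "n \<ge> 1"
  obtains L where "\<And>k. 1 \<le> k \<Longrightarrow> k \<le> n \<Longrightarrow> k dvd L" "L > 0" "L \<le> n ^ card {p. prime p \<and> p \<le> n}"
proof -
  let ?P = "{p. prime p \<and> p \<le> n}"
  have fin: "finite ?P" by simp
  have "\<exists>e. p ^ e \<le> n \<and> n < p ^ Suc e" if "p \<in> ?P" for p
    using that assms ex_power_ivl1[of p n] by (auto dest: prime_ge_2_nat)
  then obtain e where e: "\<And>p. p \<in> ?P \<Longrightarrow> p ^ e p \<le> n \<and> n < p ^ Suc (e p)" by metis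
  define L where "L = (\<Prod>p\<in>?P. p ^ e p)"
  have L: "L > 0" unfolding L_def by (auto intro!: prod_pos simp: prime_gt_0_nat)
  show ?thesis
  proof
    show "L > 0" by (rule L)
    show "L \<le> n ^ card ?P"
      unfolding L_def using e by (intro prod_le_power) (use assms in auto)
    fix k assume k: "1 \<le> k" "k \<le> n"
    show "k dvd L"
    proof (rule multiplicity_le_imp_dvd)
      show "k \<noteq> 0" using k by simp
      fix p :: nat assume p: "prime p"
      show "multiplicity p k \<le> multiplicity p L"
      proof (cases "p \<le> n")
        case True
        hence "multiplicity p L = e p"
          unfolding L_def using p multiplicity_prod_prime_powers[OF fin, of p e] by simp
        moreover have "p ^ multiplicity p k \<le> n"
          using dvd_imp_le[OF multiplicity_dvd, of k p] k by linarith
        \<comment> \<open>Maximality of \<open>e p\<close>: a power of \<open>p\<close> dividing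
          \<open>k \<le> n\<close> cannot reach the exponent \<open>Suc (e p)\<close>.\<close>
        hence "p ^ multiplicity p k < p ^ Suc (e p)" using e[of p] p True by (auto intro: le_less_trans)
        hence "multiplicity p k < Suc (e p)" using p by (meson power_less_imp_less_exp prime_gt_1_nat)
        ultimately show ?thesis by simp
      next
        case False
        hence "\<not> p dvd k" using k by (auto dest: dvd_imp_le)
        thus ?thesis by (simp add: not_dvd_imp_multiplicity_0)
      qed
    qed
  qed
qed

text \<open>Take logarithms in \<open>2 ^ n \<le> (n + 1) * n ^ ?c\<close>; \<open>n \<ge> 2\<close>
  makes \<open>ln n\<close> positive for the division.\<close>

lemma chebyshev_lower_bound:
  fixes n :: nat
  assumes "n \<ge> 2"
  shows "real (card {p::nat. prime p \<and> p \<le> n}) \<ge> (real n * ln 2 - ln (real n + 1)) / ln (real n)"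
proof -
  let ?c = "card {p::nat. prime p \<and> p \<le> n}"
  obtain L where L: "\<And>k. 1 \<le> k \<Longrightarrow> k \<le> n \<Longrightarrow> k dvd L" "L > 0" "L \<le> n ^ ?c"
    using common_multiple_le_power_card_primes[of n] assms by auto
  have "2 ^ n \<le> (n + 1) * L" using L by (intro two_power_le_common_multiple) auto
  also have "\<dots> \<le> (n + 1) * n ^ ?c" using L(3) by (rule mult_le_mono2)
  finally have "real (2 ^ n) \<le> real ((n + 1) * n ^ ?c)" by (subst of_nat_le_iff)
  hence "2 ^ n \<le> (real n + 1) * real n ^ ?c" by (simp add: algebra_simps)
  moreover have "(real n + 1) * real n ^ ?c > 0" using assms by simp
  ultimately have "ln (2 ^ n) \<le> ln ((real n + 1) * real n ^ ?c)" by simp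
  also have "\<dots> = ln (real n + 1) + real ?c * ln (real n)"
    using assms by (subst ln_mult) (auto simp: ln_realpow)
  finally have "real n * ln 2 - ln (real n + 1) \<le> real ?c * ln (real n)"
    by (simp add: ln_realpow)
  thus ?thesis using assms by (simp add: divide_le_eq)
qed

section \<open>Largest prime divisors and insulators\<close>

lemma le_largest_prime_divisor:
  assumes "prime p" "p dvd n" "n \<noteq> 0"
  shows "p \<le> largest_prime_divisor n"
proof -
  have "\<bar>n\<bar> \<noteq> 1" using assms(1,2) by (metis dvd_abs_iff not_prime_unit)
  thus ?thesis
    using assms finite_prime_divisors[of n] by (auto simp: largest_prime_divisor_def)
qed

lemma largest_prime_divisor_prime_or_1:
  assumes "n \<noteq> 0"
  shows "largest_prime_divisor n = 1 \<or>
    prime (largest_prime_divisor n) \<and> largest_prime_divisor n dvd n"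
proof (cases "\<bar>n\<bar> = 1")
  case False
  then obtain p where "prime p" "p dvd n"
    using assms prime_divisor_exists[of n] by auto
  hence "Max {p. prime p \<and> p dvd n} \<in> {p. prime p \<and> p dvd n}"
    using finite_prime_divisors[OF assms] by (intro Max_in) auto
  thus ?thesis using False by (simp add: largest_prime_divisor_def)
qed (simp add: largest_prime_divisor_def)

lemma largest_prime_divisor_ge_1: "n \<noteq> 0 \<Longrightarrow> largest_prime_divisor n \<ge> 1"
  using largest_prime_divisor_prime_or_1[of n] prime_ge_1_int by auto

lemma largest_prime_divisor_mono:
  assumes "m dvd n" "n \<noteq> 0"
  shows "largest_prime_divisor m \<le> largest_prime_divisor n"
proof -
  have "m \<noteq> 0" using assms by auto
  from largest_prime_divisor_prime_or_1[OF this] show ?thesis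
    using largest_prime_divisor_ge_1[of n] le_largest_prime_divisor[of _ n] assms
    by (metis dvd_trans)
qed

lemma prime_dvd_fact_int:
  assumes "prime (p::int)"
  shows "p dvd fact n \<longleftrightarrow> p \<le> int n"
proof -
  have p: "p = int (nat p)" using assms prime_ge_0_int by simp
  have "p dvd fact n \<longleftrightarrow> nat p dvd fact n"
    by (subst p) (metis of_nat_dvd_iff of_nat_fact)
  also have "\<dots> \<longleftrightarrow> nat p \<le> n"
    using assms p by (intro prime_dvd_fact_iff) (metis prime_nat_int_transfer)
  finally show ?thesis by (simp add: nat_le_iff)
qed

text \<open>The \<open>LEAST\<close> in \<open>insulator\<close> needs some admissible multiplier.
  The factorial of the largest prime divisor is one: it contains all primes up to that bound and
  adds none above it.\<close>

lemma insulated_mult_insulator: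
  assumes "n \<noteq> 0"
  shows "insulator n > 0 \<and> insulated (n * int (insulator n))"
proof -
  let ?P = "largest_prime_divisor n"
  let ?m = "fact (nat ?P) :: nat"
  let ?N = "n * int ?m"
  have P: "?P \<ge> 1" by (rule largest_prime_divisor_ge_1[OF assms])
  have N: "?N \<noteq> 0" using assms by simp
  have "p dvd ?N" if p: "prime p" "p \<le> largest_prime_divisor ?N" for p
  proof -
    have "largest_prime_divisor ?N \<le> ?P"
      using largest_prime_divisor_prime_or_1[OF N] P le_largest_prime_divisor[of _ n] assms
        prime_dvd_fact_int[of "largest_prime_divisor ?N" "nat ?P"]
      by (auto simp: prime_dvd_mult_iff)
    hence "p dvd fact (nat ?P)" using p P by (subst prime_dvd_fact_int) auto
    thus ?thesis by simp
  qed
  hence "?m > 0 \<and> insulated ?N" using N by (simp add: insulated_def)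
  thus ?thesis unfolding insulator_def by (rule LeastI)
qed

lemma prod_primes_dvd:
  fixes n :: nat
  assumes "finite P" "\<And>p. p \<in> P \<Longrightarrow> prime p \<and> p dvd n"
  shows "\<Prod>P dvd n"
  using assms
proof (induction P rule: finite_induct)
  case (insert p P)
  have "coprime p (\<Prod>P)"
    using insert by (intro prod_coprime_right) (metis insertCI primes_coprime)
  then show ?case using insert by (simp add: divides_mult)
qed simp

text \<open>The primes counted are distinct divisors of \<open>n * insulator n\<close>, so their
  product divides it, and each is at least 2.\<close>

lemma two_power_card_primes_le:
  assumes "n \<noteq> 0"
  shows "2 ^ card {p::nat. prime p \<and> int p \<le> largest_prime_divisor n} \<le> \<bar>n\<bar> * int (insulator n)"
proof -
  let ?P = "{p::nat. prime p \<and> int p \<le> largest_prime_divisor n}"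
  define N where "N = n * int (insulator n)"
  from insulated_mult_insulator[OF assms] have ins: "insulated N" and I: "insulator n > 0"
    by (auto simp: N_def)
  have N: "N \<noteq> 0" using assms I by (simp add: N_def)
  \<comment> \<open>Insulation of \<open>N\<close> speaks of primes up to the bound for
    \<open>N\<close>, which must cover those up to the bound for \<open>n\<close>.\<close>
  have "largest_prime_divisor n \<le> largest_prime_divisor N"
    using N by (intro largest_prime_divisor_mono) (auto simp: N_def)
  hence "int p dvd N" if "p \<in> ?P" for p
    using that ins by (auto simp: insulated_def)
  hence dvd: "p dvd nat \<bar>N\<bar>" if "p \<in> ?P" for p
    using that by (simp add: int_dvd_int_iff[symmetric])
  have "2 ^ card ?P = (\<Prod>p\<in>?P. 2::nat)" by simp
  also have "\<dots> \<le> \<Prod>?P" by (intro prod_mono) (auto intro: prime_ge_2_nat)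
  also have "\<Prod>?P dvd nat \<bar>N\<bar>"
    by (rule prod_primes_dvd) (use dvd in \<open>auto intro: finite_subset[of _ "{..nat (largest_prime_divisor n)}"]\<close>)
  hence "\<Prod>?P \<le> nat \<bar>N\<bar>" using N by (intro dvd_imp_le) auto
  finally have "int (2 ^ card ?P) \<le> int (nat \<bar>N\<bar>)" by (subst of_nat_le_iff)
  thus ?thesis using I by (simp add: N_def abs_mult)
qed

section \<open>Heights of triples and the finiteness theorem\<close>

lemma abs_le_height: "\<bar>A\<bar> \<le> height (A, B, C)" "\<bar>B\<bar> \<le> height (A, B, C)" "\<bar>C\<bar> \<le> height (A, B, C)"
  by simp_all

lemma finite_height_le: "finite {T. height T \<le> K}"
proof (rule finite_subset)
  show "{T. height T \<le> K} \<subseteq> {-K..K} \<times> {-K..K} \<times> {-K..K}" by auto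
qed simp

lemma ln_height_ge:
  assumes "T \<in> XYZ_triples"
  shows "real (card {p::nat. prime p \<and> int p \<le> smoothness T}) * ln 2
    \<le> 3 * ln (real_of_int (height T)) + ln (real (triple_insulator T))"
proof -
  obtain A B C where T: "T = (A, B, C)" by (cases T)
  define H where "H = height T"
  define I where "I = triple_insulator T"
  have nz: "A * B * C \<noteq> 0" using assms by (simp add: T XYZ_triples_def)
  have le: "\<bar>A\<bar> \<le> H" "\<bar>B\<bar> \<le> H" "\<bar>C\<bar> \<le> H" unfolding H_def T by (rule abs_le_height)+
  have H: "H \<ge> 1" using nz le(1) by auto
  have I: "I > 0" using insulated_mult_insulator[OF nz] by (simp add: I_def T)
  have "\<bar>A * B * C\<bar> \<le> H ^ 3"
    unfolding abs_mult power3_eq_cube using le H by (intro mult_mono) auto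
  hence "2 ^ card {p::nat. prime p \<and> int p \<le> smoothness T} \<le> H ^ 3 * int I"
    using two_power_card_primes_le[OF nz] mult_right_mono[of "\<bar>A * B * C\<bar>" "H ^ 3" "int I"]
    by (simp add: T I_def)
  hence "real_of_int (2 ^ card {p::nat. prime p \<and> int p \<le> smoothness T}) \<le> real_of_int (H ^ 3 * int I)"
    by (subst of_int_le_iff)
  hence "ln (2 ^ card {p::nat. prime p \<and> int p \<le> smoothness T}) \<le> ln (real_of_int H ^ 3 * real I)"
    using H I by (subst ln_le_cancel_iff) auto
  thus ?thesis using H I by (simp add: ln_mult ln_realpow H_def[symmetric] I_def[symmetric])
qed

theorem mainTheorem1:
  fixes I\<^sub>0 :: nat
  assumes xyz_upper: "\<And>\<epsilon>::real. \<epsilon> > 0 \<Longrightarrow>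
      finite {T \<in> XYZ_triples.
        ln (real_of_int (height T)) > real_of_int (smoothness T) powr (2/3 + \<epsilon>)}"
    and xyz_lower: "\<And>\<epsilon>::real. \<epsilon> > 0 \<Longrightarrow>
      infinite {T \<in> XYZ_triples.
        ln (real_of_int (height T)) > real_of_int (smoothness T) powr (2/3 - \<epsilon>)}"
    and I0_pos: "I\<^sub>0 > 0"
  shows "finite {T \<in> XYZ_triples. triple_insulator T = I\<^sub>0}"
proof -
  define a where "a = ln (real I\<^sub>0)"
  \<comment> \<open>The right side has order \<open>n / ln n\<close>, which beats
    \<open>n powr (5/6)\<close>. The exponent is 2/3 + 1/6; any exponent below 1 would do
    here.\<close>
  have "\<forall>\<^sub>F n::nat in sequentially.
      3 * real n powr (5/6) + a < (real n * ln 2 - ln (real n + 1)) / ln (real n) * ln 2"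
    by real_asymp
  then obtain N where N: "\<And>n. n \<ge> N \<Longrightarrow>
      3 * real n powr (5/6) + a < (real n * ln 2 - ln (real n + 1)) / ln (real n) * ln 2"
    by (auto simp: eventually_at_top_linorder)
  \<comment> \<open>The 2 is the range of the Chebyshev bound.\<close>
  define M where "M = max 2 N"
  define E where "E = {T \<in> XYZ_triples.
    ln (real_of_int (height T)) > real_of_int (smoothness T) powr (2/3 + 1/6)}"
  define K where "K = \<lfloor>exp (real M powr (5/6))\<rfloor>"
  have "height T \<le> K"
    if T: "T \<in> XYZ_triples" "triple_insulator T = I\<^sub>0" "T \<notin> E" for T
  proof -
    obtain A B C where ABC: "T = (A, B, C)" by (cases T)
    have nz: "A * B * C \<noteq> 0" using T(1) by (simp add: ABC XYZ_triples_def)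
    have H: "height T > 0" using nz abs_le_height(1)[of A B C] by (auto simp: ABC)
    define s where "s = nat (smoothness T)"
    have s: "smoothness T = int s"
      using largest_prime_divisor_ge_1[OF nz] by (simp add: s_def ABC)
    have up: "ln (real_of_int (height T)) \<le> real s powr (5/6)"
      using T s by (simp add: E_def not_less)
    \<comment> \<open>Otherwise the prime count forces \<open>ln (height T) > s powr (5/6)\<close>,
      contradicting \<open>T \<notin> E\<close>.\<close>
    have "s < M"
    proof (rule ccontr)
      assume "\<not> s < M"
      hence ge: "s \<ge> 2" "s \<ge> N" by (auto simp: M_def)
      have "3 * real s powr (5/6) + a < (real s * ln 2 - ln (real s + 1)) / ln (real s) * ln 2"
        using N ge by blast
      also have "\<dots> \<le> real (card {p::nat. prime p \<and> p \<le> s}) * ln 2"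
        using chebyshev_lower_bound[OF ge(1)] by (intro mult_right_mono) auto
      also have "\<dots> \<le> 3 * ln (real_of_int (height T)) + a"
        using ln_height_ge[OF T(1)] T(2) by (simp add: s a_def)
      finally show False using up by simp
    qed
    hence "real s powr (5/6) \<le> real M powr (5/6)" by (intro powr_mono2) auto
    with up have "real_of_int (height T) \<le> exp (real M powr (5/6))"
      using H by (metis dual_order.trans exp_le_cancel_iff exp_ln of_int_0_less_iff)
    thus ?thesis by (simp add: K_def le_floor_iff)
  qed
  hence "{T \<in> XYZ_triples. triple_insulator T = I\<^sub>0} \<subseteq> E \<union> {T. height T \<le> K}" by blast
  moreover have "finite E" unfolding E_def by (rule xyz_upper) simp
  ultimately show ?thesis using finite_height_le by (meson finite_UnI finite_subset)
qed

end
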